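(* Let $\mathfrak m$ be an uncountable cardinal satisfying $\sup\{\mathfrak m^{\mathfrak n} : \mathfrak n<\mathfrak m\}=\mathfrak m$. Let $\mathrm{Iso}(\mathbb U_{\mathfrak m})$ be the group of isometries of the Urysohn--Katětov metric space $\mathbb U_{\mathfrak m}$ of weight $\mathfrak m$, equipped with the topology of simple convergence on $\mathbb U_{\mathfrak m}$. Suppose $G$ is a topological subgroup of $\mathrm{Iso}(\mathbb U_{\mathfrak m})$ of density $<\mathfrak m$ having property $(OB)$. Then $G$ is functionally balanced.
   Context: For an infinite cardinal $\mathfrak m$ with $\sup\{\mathfrak m^{\mathfrak n}:\mathfrak n<\mathfrak m\}=\mathfrak m$, $\mathbb U_{\mathfrak m}$ denotes the complete metric space of weight $\mathfrak m$, unique up to isometry (Katětov), which contains an isometric copy of every metric space of weight $\le\mathfrak m$ and is $<\mathfrak m$-homogeneous: every isometry between two metric subspaces of density $<\mathfrak m$ extends to a self-isometry of the whole space. It has the one-point extension property: call a $1$-Lipschitz function $f:Y\to\mathbb R$ on a metric space $Y$ a Katětov function if $d(x,y)\le f(x)+f(y)$ for all $x,y\in Y$; if $Y\subseteq\mathbb U_{\mathfrak m}$ has density $<\mathfrak m$ and $f$ is a Katětov function on $Y$, then there is $z\in\mathbb U_{\mathfrak m}$ with $d(z,y)=f(y)$ for all $y\in Y$. The topology of simple convergence on $\mathrm{Iso}(\mathbb U_{\mathfrak m})$ is the topology of pointwise convergence on $\mathbb U_{\mathfrak m}$ (with its metric topology); a neighbourhood basis at the identity consists of the sets $\{g : d(x_i,gx_i)<\varepsilon,\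 i=1,\dots,n\}$ with $x_1,\dots,x_n\in\mathbb U_{\mathfrak m}$ and $\varepsilon>0$. The density of a topological space is the smallest cardinality of a dense subset; its weight is the smallest cardinality of a base. A topological group $G$ has property $(OB)$ if every continuous left-invariant pseudometric on $G$ is bounded; equivalently, every orbit of each continuous action of $G$ by isometries on a metric space is bounded. A real-valued function $f$ on a topological group $G$ is left (respectively right) uniformly continuous if for every $\varepsilon>0$ there is a neighbourhood $V$ of the identity with $|f(x)-f(y)|<\varepsilon$ whenever $x^{-1}y\in V$ (respectively $xy^{-1}\in V$). $G$ is functionally balanced if every right uniformly continuous bounded real-valued function on $G$ is left uniformly continuous. *)

theory Defs
  imports "HOL-Analysis.Analysis" "HOL-Algebra.Group"
begin

unbundle cardinal_syntax

section \<open>Cardinals\<close>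

text \<open>
  Least upper bound of a family of cardinals. It is enough to let the competing bound \<open>k\<close> range
  over cardinals carried by the same type as \<open>m\<close>: a cardinal (on any type) that is not at least
  \<open>m\<close> is smaller than \<open>m\<close>, hence equipotent to a cardinal on a subset of \<open>Field m\<close>.
\<close>

definition is_card_Sup :: "'b rel set \<Rightarrow> 'm rel \<Rightarrow> bool" where
  "is_card_Sup R m \<longleftrightarrow>
     Card_order m \<and>
     (\<forall>r\<in>R. r \<le>o m) \<and>
     (\<forall>k :: 'm rel. Card_order k \<and> (\<forall>r\<in>R. r \<le>o k) \<longrightarrow> m \<le>o k)"

definition min_card :: "'a set set \<Rightarrow> 'a rel" where
  "min_card \<A> = |SOME A. A \<in> \<A> \<and> (\<forall>B\<in>\<A>. |A| \<le>o |B| )|"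

lemma min_card_attained:
  assumes "\<A> \<noteq> {}"
  obtains A where "A \<in> \<A>" "min_card \<A> = |A|" "\<And>B. B \<in> \<A> \<Longrightarrow> |A| \<le>o |B|"
proof -
  have "\<exists>r\<in>card_of ` \<A>. \<forall>r'\<in>card_of ` \<A>. r \<le>o r'"
    by (rule exists_minim_Card_order) (use assms card_of_Card_order in auto)
  then have "\<exists>A. A \<in> \<A> \<and> (\<forall>B\<in>\<A>. |A| \<le>o |B| )"
    by blast
  from someI_ex[OF this] show thesis
    by (intro that[of "SOME A. A \<in> \<A> \<and> (\<forall>B\<in>\<A>. |A| \<le>o |B| )"]) (auto simp: min_card_def)
qed

definition top_density :: "'a topology \<Rightarrow> 'a rel" where
  "top_density X = min_card {D. D \<subseteq> topspace X \<and> X closure_of D = topspace X}"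

definition base_of_topology :: "'a topology \<Rightarrow> 'a set set \<Rightarrow> bool" where
  "base_of_topology X \<B> \<longleftrightarrow>
     (\<forall>V\<in>\<B>. openin X V) \<and>
     (\<forall>U x. openin X U \<and> x \<in> U \<longrightarrow> (\<exists>V\<in>\<B>. x \<in> V \<and> V \<subseteq> U))"

definition top_weight :: "'a topology \<Rightarrow> 'a set rel" where
  "top_weight X = min_card {\<B>. base_of_topology X \<B>}"

lemma top_density_attained:
  obtains D where "D \<subseteq> topspace X" "X closure_of D = topspace X" "top_density X = |D|"
    "\<And>E. E \<subseteq> topspace X \<Longrightarrow> X closure_of E = topspace X \<Longrightarrow> |D| \<le>o |E|"
proof -
  have "topspace X \<in> {D. D \<subseteq> topspace X \<and> X closure_of D = topspace X}"
    by simp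
  then have "{D. D \<subseteq> topspace X \<and> X closure_of D = topspace X} \<noteq> {}"
    by blast
  from min_card_attained[OF this] show thesis
    using that unfolding top_density_def by (smt (verit) mem_Collect_eq)
qed

lemma top_weight_attained:
  obtains \<B> where "base_of_topology X \<B>" "top_weight X = |\<B>|"
    "\<And>\<C>. base_of_topology X \<C> \<Longrightarrow> |\<B>| \<le>o |\<C>|"
proof -
  have "Collect (openin X) \<in> {\<B>. base_of_topology X \<B>}"
    by (auto simp: base_of_topology_def)
  then have "{\<B>. base_of_topology X \<B>} \<noteq> {}"
    by blast
  from min_card_attained[OF this] show thesis
    using that unfolding top_weight_def by (smt (verit) mem_Collect_eq)
qed


section \<open>The isometry group and the Urysohn--Katetov space\<close>

definition isometric_on :: "'u::metric_space set \<Rightarrow> ('u \<Rightarrow> 'u) \<Rightarrow> bool" where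
  "isometric_on A f \<longleftrightarrow> (\<forall>x\<in>A. \<forall>y\<in>A. dist (f x) (f y) = dist x y)"

definition Iso :: "('u::metric_space \<Rightarrow> 'u) monoid" where
  "Iso = \<lparr>carrier = {g. bij g \<and> isometric_on UNIV g}, monoid.mult = (\<circ>), one = id\<rparr>"

lemma group_Iso: "group (Iso :: ('u::metric_space \<Rightarrow> 'u) monoid)"
proof (rule groupI)
  fix g :: "'u \<Rightarrow> 'u"
  assume "g \<in> carrier Iso"
  then have g: "bij g" "\<And>x y. dist (g x) (g y) = dist x y"
    by (auto simp: Iso_def isometric_on_def)
  have "dist (inv_into UNIV g x) (inv_into UNIV g y) = dist x y" for x y
    using g by (metis bij_inv_eq_iff)
  then have "inv_into UNIV g \<in> carrier Iso"
    using g(1) by (simp add: Iso_def isometric_on_def bij_imp_bij_inv)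
  moreover have "inv_into UNIV g \<circ> g = id"
    using g(1) by (simp add: bij_is_inj)
  ultimately show "\<exists>h\<in>carrier Iso. h \<otimes>\<^bsub>Iso\<^esub> g = \<one>\<^bsub>Iso\<^esub>"
    by (auto simp: Iso_def)
qed (auto simp: Iso_def isometric_on_def bij_comp comp_assoc)

definition simple_convergence :: "('u::metric_space \<Rightarrow> 'u) topology" where
  "simple_convergence =
     subtopology (product_topology (\<lambda>_. euclidean) UNIV) (carrier Iso)"

text \<open>
  \<open>urysohn_katetov m TYPE('u)\<close>: the metric space \<open>'u\<close> is complete, has weight \<open>m\<close>, contains an
  isometric copy of every metric space of weight at most \<open>m\<close>, and is homogeneous with respect to
  subspaces of density less than \<open>m\<close>.

  HOL cannot quantify over all types inside a definition, so the universality clause ranges over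
  the metric spaces \<open>(M, d)\<close> with \<open>M\<close> a set of elements of \<open>'u\<close> and \<open>d\<close> an arbitrary metric on \<open>M\<close>,
  unrelated to \<^term>\<open>dist\<close>. When \<open>m\<close> is infinite and satisfies the condition
  \<open>sup {m ^ n | n. n < m} = m\<close>, nothing is lost: a metric space of weight at most \<open>m\<close> has at most
  \<open>m ^ \<aleph>\<^sub>0\<close> points. If \<open>m\<close> is uncountable this number equals \<open>m\<close>, while \<open>'u\<close> has at least \<open>m\<close> points,
  having weight \<open>m\<close>; and if \<open>m = \<aleph>\<^sub>0\<close>, the clause applied to countable metric spaces and
  completeness already give \<open>'u\<close> the cardinality of the continuum. So every metric space of
  weight at most \<open>m\<close>, on whatever type, is isometric to one of the spaces considered.
\<close>

definition urysohn_katetov :: "'m rel \<Rightarrow> 'u::metric_space itself \<Rightarrow> bool" where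
  "urysohn_katetov m U \<longleftrightarrow>
     complete (UNIV :: 'u set) \<and>
     top_weight (euclidean :: 'u topology) =o m \<and>
     (\<forall>(M :: 'u set) d. Metric_space M d \<and> top_weight (Metric_space.mtopology M d) \<le>o m \<longrightarrow>
        (\<exists>f :: 'u \<Rightarrow> 'u. \<forall>x\<in>M. \<forall>y\<in>M. dist (f x) (f y) = d x y)) \<and>
     (\<forall>(A :: 'u set) B f.
        top_density (top_of_set A) <o m \<and> top_density (top_of_set B) <o m \<and>
        f ` A = B \<and> isometric_on A f \<longrightarrow>
        (\<exists>g\<in>carrier Iso. \<forall>x\<in>A. g x = f x))"


section \<open>Topological groups\<close>

text \<open>
  A topological group is given by a group \<open>G\<close> and a topology \<open>T\<close> with \<open>topspace T = carrier G\<close>;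
  conditions are only imposed on elements of the carrier.
\<close>

definition left_invariant_pseudometric :: "('a, 'b) monoid_scheme \<Rightarrow> ('a \<Rightarrow> 'a \<Rightarrow> real) \<Rightarrow> bool" where
  "left_invariant_pseudometric G d \<longleftrightarrow>
     (\<forall>x\<in>carrier G. \<forall>y\<in>carrier G. 0 \<le> d x y) \<and>
     (\<forall>x\<in>carrier G. d x x = 0) \<and>
     (\<forall>x\<in>carrier G. \<forall>y\<in>carrier G. d x y = d y x) \<and>
     (\<forall>x\<in>carrier G. \<forall>y\<in>carrier G. \<forall>z\<in>carrier G. d x z \<le> d x y + d y z) \<and>
     (\<forall>g\<in>carrier G. \<forall>x\<in>carrier G. \<forall>y\<in>carrier G. d (g \<otimes>\<^bsub>G\<^esub> x) (g \<otimes>\<^bsub>G\<^esub> y) = d x y)"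

definition property_OB :: "('a, 'b) monoid_scheme \<Rightarrow> 'a topology \<Rightarrow> bool" where
  "property_OB G T \<longleftrightarrow>
     (\<forall>d. left_invariant_pseudometric G d \<and>
          continuous_map (prod_topology T T) euclideanreal (\<lambda>(x, y). d x y) \<longrightarrow>
          (\<exists>C. \<forall>x\<in>carrier G. \<forall>y\<in>carrier G. d x y \<le> C))"

definition left_uniformly_continuous ::
    "('a, 'b) monoid_scheme \<Rightarrow> 'a topology \<Rightarrow> ('a \<Rightarrow> real) \<Rightarrow> bool" where
  "left_uniformly_continuous G T f \<longleftrightarrow>
     (\<forall>\<epsilon>>0. \<exists>V. openin T V \<and> \<one>\<^bsub>G\<^esub> \<in> V \<and>
        (\<forall>x\<in>carrier G. \<forall>y\<in>carrier G. inv\<^bsub>G\<^esub> x \<otimes>\<^bsub>G\<^esub> y \<in> V \<longrightarrow> \<bar>f x - f y\<bar> < \<epsilon>))"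

definition right_uniformly_continuous ::
    "('a, 'b) monoid_scheme \<Rightarrow> 'a topology \<Rightarrow> ('a \<Rightarrow> real) \<Rightarrow> bool" where
  "right_uniformly_continuous G T f \<longleftrightarrow>
     (\<forall>\<epsilon>>0. \<exists>V. openin T V \<and> \<one>\<^bsub>G\<^esub> \<in> V \<and>
        (\<forall>x\<in>carrier G. \<forall>y\<in>carrier G. x \<otimes>\<^bsub>G\<^esub> inv\<^bsub>G\<^esub> y \<in> V \<longrightarrow> \<bar>f x - f y\<bar> < \<epsilon>))"

definition functionally_balanced :: "('a, 'b) monoid_scheme \<Rightarrow> 'a topology \<Rightarrow> bool" where
  "functionally_balanced G T \<longleftrightarrow>
     (\<forall>f. bounded (f ` carrier G) \<and> right_uniformly_continuous G T f \<longrightarrow>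
          left_uniformly_continuous G T f)"

end

theory Submission
  imports Defs
begin

text \<open>
  A right uniformly continuous \<open>f\<close> is governed by the displacement of \<open>inv g w\<^sub>1, \<dots>, inv g w\<^sub>n\<close> for
  finitely many points, and these can be merged into a single point \<open>w\<close>. So \<open>f g\<close> is, up to a small
  error, \<open>\<psi> (inv g w)\<close> for a bounded Lipschitz function \<open>\<psi>\<close> on the orbit of \<open>w\<close>. The orbit is bounded by
  property (OB) and has density less than \<open>m\<close>, so after rescaling and adding a constant \<open>\<psi>\<close> becomes a
  Katetov function, realised as the distance to a point \<open>z\<close>. If \<open>u\<close> nearly fixes \<open>z\<close>, then \<open>\<psi>\<close> is
  nearly invariant under \<open>u\<close> on the whole orbit at once, which is left uniform continuity of \<open>f\<close>.
\<close>

section \<open>Density and one-point extensions\<close>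

lemma top_density_less_iff:
  "top_density X <o m \<longleftrightarrow> (\<exists>D\<subseteq>topspace X. X closure_of D = topspace X \<and> |D| <o m)"
proof
  assume "top_density X <o m"
  then show "\<exists>D\<subseteq>topspace X. X closure_of D = topspace X \<and> |D| <o m"
    by (metis top_density_attained)
next
  assume "\<exists>D\<subseteq>topspace X. X closure_of D = topspace X \<and> |D| <o m"
  then show "top_density X <o m"
    by (metis top_density_attained ordLeq_ordLess_trans)
qed

lemma top_density_continuous_image_less:
  assumes "continuous_map X Y f" "f ` topspace X = topspace Y" "top_density X <o m"
  shows "top_density Y <o m"
proof -
  obtain D where D: "D \<subseteq> topspace X" "X closure_of D = topspace X" "|D| <o m"
    using assms(3) by (auto simp: top_density_less_iff)
  have "f ` topspace X \<subseteq> Y closure_of (f ` D)"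
    using continuous_map_image_closure_subset[OF assms(1), of D] D(2) by simp
  then have "Y closure_of (f ` D) = topspace Y"
    using assms(2) closure_of_subset_topspace[of Y "f ` D"] by auto
  moreover have "|f ` D| <o m"
    using card_of_image D(3) ordLeq_ordLess_trans by blast
  ultimately show ?thesis
    unfolding top_density_less_iff using D(1) assms(2) by (intro exI[of _ "f ` D"]) auto
qed

lemma infinite_Field_if_natLeq_less:
  assumes "natLeq <o m" shows "infinite (Field m)"
  using cinfinite_mono[OF ordLess_imp_ordLeq[OF assms] natLeq_cinfinite] by (simp add: cinfinite_def)

lemma top_density_Un_less:
  fixes A B :: "'a::topological_space set"
  assumes "Card_order m" "natLeq <o m"
    and "top_density (top_of_set A) <o m" "top_density (top_of_set B) <o m"
  shows "top_density (top_of_set (A \<union> B)) <o m"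
proof -
  have *: "\<exists>D\<subseteq>S. S \<subseteq> closure D \<and> |D| <o m" if S: "top_density (top_of_set S) <o m" for S :: "'a set"
  proof -
    obtain D where D: "D \<subseteq> S" "top_of_set S closure_of D = S" "|D| <o m"
      using S by (auto simp: top_density_less_iff)
    have "S \<subseteq> closure D"
      using D(1,2) by (simp add: closure_of_subtopology Int_absorb1) blast
    then show ?thesis using D by blast
  qed
  obtain D where D: "D \<subseteq> A" "A \<subseteq> closure D" "|D| <o m"
    using *[OF assms(3)] by blast
  obtain E where E: "E \<subseteq> B" "B \<subseteq> closure E" "|E| <o m"
    using *[OF assms(4)] by blast
  have "|D \<union> E| <o m"
    using card_of_Un_ordLess_infinite_Field infinite_Field_if_natLeq_less assms D(3) E(3) by blast
  moreover have "A \<union> B \<subseteq> closure (D \<union> E)"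
    using D(2) E(2) by auto
  then have "top_of_set (A \<union> B) closure_of (D \<union> E) = A \<union> B"
    by (simp only: closure_of_subtopology Int_absorb1[OF Un_mono[OF D(1) E(1)]]
      euclidean_closure_of Int_absorb2)
  ultimately show ?thesis
    unfolding top_density_less_iff using D(1) E(1) by (intro exI[of _ "D \<union> E"]) auto
qed

text \<open>The balls of radius \<open>1 / (n + 1)\<close> about points of \<open>D\<close> form a
  base, and there are at most |D| times aleph-zero of them, fewer than the uncountable
  \<open>m\<close>.\<close>

lemma (in Metric_space) top_weight_less_if_dense:
  assumes m: "Card_order m" "natLeq <o m"
    and D: "D \<subseteq> M" "|D| <o m" "\<And>x e. x \<in> M \<Longrightarrow> 0 < e \<Longrightarrow> \<exists>y\<in>D. d x y < e"
  shows "top_weight mtopology <o m"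
proof -
  define \<B> where "\<B> = (\<lambda>(x, n). mball x (inverse (real (Suc n)))) ` (D \<times> UNIV)"
  have "base_of_topology mtopology \<B>"
    unfolding base_of_topology_def
  proof (intro conjI ballI allI impI)
    fix V assume "V \<in> \<B>" then show "openin mtopology V"
      by (auto simp: \<B>_def)
  next
    fix U x assume U: "openin mtopology U \<and> x \<in> U"
    then obtain r where r: "r > 0" "mball x r \<subseteq> U" and x: "x \<in> M"
      by (meson openin_mtopology subsetD)
    \<comment> \<open>Half of \<open>r\<close>, since the ball about \<open>y\<close> reaches at
      most twice its radius away from \<open>x\<close>.\<close>
    obtain n where n: "inverse (real (Suc n)) < r / 2"
      using reals_Archimedean[of "r / 2"] r(1) by auto
    obtain y where y: "y \<in> D" "d x y < inverse (real (Suc n))"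
      using D(3)[OF x, of "inverse (real (Suc n))"] by auto
    have "mball y (inverse (real (Suc n))) \<subseteq> mball x r"
    proof
      fix z assume "z \<in> mball y (inverse (real (Suc n)))"
      then have "z \<in> M" "y \<in> M" "d y z < inverse (real (Suc n))" by auto
      then show "z \<in> mball x r"
        using triangle[OF x, of y z] x y(2) n by auto
    qed
    moreover have "x \<in> mball y (inverse (real (Suc n)))"
      using x y D(1) by (auto simp: commute)
    moreover have "mball y (inverse (real (Suc n))) \<in> \<B>"
      using y(1) by (auto simp: \<B>_def)
    ultimately show "\<exists>V\<in>\<B>. x \<in> V \<and> V \<subseteq> U"
      using r(2) by blast
  qed
  then have "top_weight mtopology \<le>o |\<B>|"
    by (metis top_weight_attained)
  also have "|\<B>| \<le>o |D \<times> (UNIV :: nat set)|"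
    unfolding \<B>_def by (rule card_of_image)
  \<comment> \<open>\<open>D\<close> may be finite, so the product is compared with a sum that is
    always infinite.\<close>
  also have "|D \<times> (UNIV :: nat set)| \<le>o |D <+> (UNIV :: nat set)|"
    by (intro card_of_Times_ordLeq_infinite_Field)
      (auto simp: card_of_Plus1 card_of_Plus2 card_of_card_order_on Field_card_of)
  also have "|D <+> (UNIV :: nat set)| <o m"
    using card_of_Plus_ordLess_infinite_Field[OF infinite_Field_if_natLeq_less[OF m(2)] m(1) D(2)]
      card_of_nat m(2) ordIso_ordLess_trans by blast
  finally show ?thesis .
qed

lemma dense_if_top_of_set_closure_of:
  fixes Y :: "'a::metric_space set"
  assumes "top_of_set Y closure_of D = Y" "D \<subseteq> Y" "x \<in> Y" "0 < e"
  shows "\<exists>y\<in>D. dist x y < e"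
proof -
  have "x \<in> closure D"
    using assms by (simp add: closure_of_subtopology Int_absorb1) blast
  then show ?thesis
    using assms(4) by (auto simp: closure_approachable dist_commute)
qed

section \<open>The one-point extension property\<close>

lemma urysohn_katetov_universal:
  fixes M :: "'u::metric_space set"
  assumes "urysohn_katetov m TYPE('u)"
    and "Metric_space M d" "top_weight (Metric_space.mtopology M d) \<le>o m"
  obtains f :: "'u \<Rightarrow> 'u" where "\<And>x y. x \<in> M \<Longrightarrow> y \<in> M \<Longrightarrow> dist (f x) (f y) = d x y"
  using assms(1)[unfolded urysohn_katetov_def, THEN conjunct2, THEN conjunct2, THEN conjunct1,
      rule_format, OF conjI, OF assms(2,3)] by blast

lemma urysohn_katetov_homogeneous:
  fixes A :: "'u::metric_space set"
  assumes "urysohn_katetov m TYPE('u)"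
    and "top_density (top_of_set A) <o m" "top_density (top_of_set (f ` A)) <o m" "isometric_on A f"
  obtains g where "g \<in> carrier Iso" "\<And>x. x \<in> A \<Longrightarrow> g x = f x"
  using assms(1)[unfolded urysohn_katetov_def, THEN conjunct2, THEN conjunct2, THEN conjunct2,
      rule_format, of A "f ` A" f] assms(2-4) by blast

text \<open>Otherwise the whole space would have weight below \<open>m\<close>. The point outside
  \<open>Y\<close> obtained this way serves as the label of a new point, since universality speaks
  of metrics on subsets of \<open>'u\<close>.\<close>

lemma urysohn_katetov_not_small:
  assumes "Card_order m" "natLeq <o m" "urysohn_katetov m TYPE('u::metric_space)"
    and "top_density (top_of_set (Y :: 'u set)) <o m"
  shows "Y \<noteq> UNIV"
proof
  assume Y: "Y = UNIV"
  obtain D where D: "D \<subseteq> Y" "top_of_set Y closure_of D = Y" "|D| <o m"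
    using assms(4) by (auto simp: top_density_less_iff)
  have "top_weight (Metric_space.mtopology (UNIV :: 'u set) dist) <o m"
    using dense_if_top_of_set_closure_of[OF D(2,1)] Y
    by (intro Met_TC.top_weight_less_if_dense[OF assms(1,2) _ D(3)]) auto
  then show False
    using assms(3) not_ordLess_ordIso by (auto simp: urysohn_katetov_def)
qed

text \<open>Adjoin a point to \<open>Y\<close> at distances \<open>\<phi>\<close>, embed the
  enlarged space by universality, and move the copy of \<open>Y\<close> back onto \<open>Y\<close>
  by homogeneity; the adjoined point lands on the required one.\<close>

lemma urysohn_katetov_one_point_extension:
  fixes Y :: "'u::metric_space set"
  assumes m: "Card_order m" "natLeq <o m" and U: "urysohn_katetov m TYPE('u)"
    and Y: "top_density (top_of_set Y) <o m"
    and lipschitz: "\<And>x y. x \<in> Y \<Longrightarrow> y \<in> Y \<Longrightarrow> \<phi> x - \<phi> y \<le> dist x y"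
    and katetov: "\<And>x y. x \<in> Y \<Longrightarrow> y \<in> Y \<Longrightarrow> dist x y \<le> \<phi> x + \<phi> y"
  shows "\<exists>z. \<forall>y\<in>Y. dist z y = \<phi> y"
proof (cases "\<exists>y\<in>Y. \<phi> y = 0")
  \<comment> \<open>A zero of \<open>\<phi>\<close> would put the new point at distance 0 from a
    point of \<open>Y\<close>; that point is then itself the solution.\<close>
  case True
  then obtain z where z: "z \<in> Y" "\<phi> z = 0" by blast
  have "dist z y = \<phi> y" if "y \<in> Y" for y
    using lipschitz[OF that z(1)] katetov[OF that z(1)] z(2) by (simp add: dist_commute)
  then show ?thesis by blast
next
  case False
  have pos: "\<phi> y > 0" if "y \<in> Y" for y
    using False katetov[OF that that] that by force
  obtain p where p: "p \<notin> Y"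
    using urysohn_katetov_not_small[OF m U Y] by blast
  \<comment> \<open>\<open>p\<close> plays the adjoined point. The absolute values keep
    \<open>d\<close> nonnegative outside \<open>insert p Y\<close> too, as
    \<open>Metric_space\<close> demands for all arguments.\<close>
  define d where "d x y = (if x = y then 0 else if x = p then \<bar>\<phi> y\<bar> else if y = p then \<bar>\<phi> x\<bar> else dist x y)"
    for x y
  have d_p: "d p y = \<phi> y" if "y \<in> Y" for y
    using pos[OF that] p that by (auto simp: d_def)
  have d_Y: "d x y = dist x y" if "x \<in> Y" "y \<in> Y" for x y
    using p that by (auto simp: d_def)
  have sym: "d x y = d y x" for x y
    by (auto simp: d_def dist_commute)
  have self: "d x x = 0" for x by (simp add: d_def)
  interpret d: Metric_space "insert p Y" d
  proof
    show "0 \<le> d x y" for x y by (auto simp: d_def)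
    show "d x y = d y x" for x y by (rule sym)
    show "d x y = 0 \<longleftrightarrow> x = y" if "x \<in> insert p Y" "y \<in> insert p Y" for x y
      using that p pos[of x] pos[of y] by (auto simp: d_def)
    show "d x z \<le> d x y + d y z"
      if xyz: "x \<in> insert p Y" "y \<in> insert p Y" "z \<in> insert p Y" for x y z
    proof -
      \<comment> \<open>With the new point in the middle the triangle inequality is the Katetov
        inequality; with it at one end it is the Lipschitz condition.\<close>
      consider "x = p" "y = p" | "y = p" "z = p" | "x = p" "y \<in> Y" "z = p" | "x \<in> Y" "y = p" "z \<in> Y"
        | "x = p" "y \<in> Y" "z \<in> Y" | "x \<in> Y" "y \<in> Y" "z = p" | "x \<in> Y" "y \<in> Y" "z \<in> Y"
        using xyz by blast
      then show ?thesis
      proof cases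
        case 3
        then show ?thesis using pos[of y] by (simp add: self sym[of y p] d_p)
      next
        case 4
        then show ?thesis using katetov[of x z] by (simp add: sym[of x p] d_p d_Y)
      next
        case 5
        then show ?thesis using lipschitz[of z y] by (simp add: d_p d_Y dist_commute)
      next
        case 6
        then show ?thesis using lipschitz[of x y] by (simp add: sym[of _ p] d_p d_Y)
      next
        case 7
        then show ?thesis by (simp add: d_Y dist_triangle)
      qed (simp_all add: self)
    qed
  qed
  obtain D where D: "D \<subseteq> Y" "top_of_set Y closure_of D = Y" "|D| <o m"
    using Y by (auto simp: top_density_less_iff)
  note inf = infinite_Field_if_natLeq_less[OF m(2)]
  have "|{p}| <o m"
    using card_order_on_well_order_on[OF m(1)] inf
    by (intro finite_ordLess_infinite) (use card_of_Well_order in \<open>simp_all add: Field_card_of\<close>)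
  then have "|insert p D| <o m"
    using card_of_Un_ordLess_infinite_Field[OF inf m(1) _ D(3), of "{p}"] by simp
  then have "top_weight d.mtopology <o m"
  proof (rule d.top_weight_less_if_dense[OF m, rotated])
    show "insert p D \<subseteq> insert p Y" using D(1) by blast
    show "\<exists>y\<in>insert p D. d x y < e" if x: "x \<in> insert p Y" "0 < e" for x e
    proof (cases "x = p")
      case True then show ?thesis using x by (auto simp: self)
    next
      case False
      then obtain y where "y \<in> D" "dist x y < e"
        using dense_if_top_of_set_closure_of[OF D(2,1) _ x(2)] x False by blast
      moreover have "x \<in> Y" "y \<in> Y" using False x(1) D(1) \<open>y \<in> D\<close> by auto
      ultimately show ?thesis using d_Y[of x y] by (intro bexI[of _ y]) simp_all
    qed
  qed
  from urysohn_katetov_universal[OF U d.Metric_space_axioms ordLess_imp_ordLeq[OF this]]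
  obtain e :: "'u \<Rightarrow> 'u"
    where e: "\<And>x y. x \<in> insert p Y \<Longrightarrow> y \<in> insert p Y \<Longrightarrow> dist (e x) (e y) = d x y"
    by metis
  have e_Y: "dist (e x) (e y) = dist x y" if "x \<in> Y" "y \<in> Y" for x y
    using e[of x y] d_Y[of x y] that by simp
  have inj: "inj_on e Y"
    by (metis dist_eq_0_iff e_Y inj_onI)
  have "continuous_on Y e"
    unfolding continuous_on_iff by (metis e_Y)
  then have eY_small: "top_density (top_of_set (e ` Y)) <o m"
    by (intro top_density_continuous_image_less[OF _ _ Y, where f = e]) auto
  \<comment> \<open>Homogeneity is applied to the inverse of \<open>e\<close>, taking the copy of
    \<open>Y\<close> back to \<open>Y\<close>.\<close>
  have "top_density (top_of_set (inv_into Y e ` (e ` Y))) <o m"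
    using Y inj by simp
  moreover have "isometric_on (e ` Y) (inv_into Y e)"
    using inj by (auto simp: isometric_on_def e_Y)
  ultimately obtain g where g: "g \<in> carrier Iso" "\<And>x. x \<in> e ` Y \<Longrightarrow> g x = inv_into Y e x"
    using urysohn_katetov_homogeneous[OF U eY_small] by metis
  then have g_e: "g (e y) = y" if "y \<in> Y" for y
    using inj that by simp
  have "dist (g (e p)) y = \<phi> y" if "y \<in> Y" for y
  proof -
    have "dist (g (e p)) (g (e y)) = dist (e p) (e y)"
      using g(1) by (simp add: Iso_def isometric_on_def)
    then show ?thesis
      using that g_e e d_p by simp
  qed
  then show ?thesis by blast
qed

section \<open>Groups of isometries\<close>

context
  fixes H :: "('u::metric_space \<Rightarrow> 'u) set"
  assumes H: "subgroup H Iso"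
begin

lemma dist_subgroup_Iso: "g \<in> H \<Longrightarrow> dist (g x) (g y) = dist x y"
  using subgroup.subset[OF H] by (auto simp: Iso_def isometric_on_def)

lemma comp_in_subgroup_Iso: "g \<in> H \<Longrightarrow> h \<in> H \<Longrightarrow> g \<circ> h \<in> H"
  using subgroup.m_closed[OF H] by (auto simp: Iso_def)

lemma id_in_subgroup_Iso: "id \<in> H"
  using subgroup.one_closed[OF H] by (auto simp: Iso_def)

lemma inv_subgroup_Iso:
  assumes "g \<in> H"
  shows "inv\<^bsub>Iso\<lparr>carrier := H\<rparr>\<^esub> g \<in> H"
    and "(inv\<^bsub>Iso\<lparr>carrier := H\<rparr>\<^esub> g) (g x) = x" "g ((inv\<^bsub>Iso\<lparr>carrier := H\<rparr>\<^esub> g) x) = x"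
proof -
  interpret K: group "Iso\<lparr>carrier := H\<rparr>"
    using subgroup.subgroup_is_group[OF H group_Iso] .
  show "inv\<^bsub>Iso\<lparr>carrier := H\<rparr>\<^esub> g \<in> H"
    using K.inv_closed assms by simp
  have "inv\<^bsub>Iso\<lparr>carrier := H\<rparr>\<^esub> g \<circ> g = id" "g \<circ> inv\<^bsub>Iso\<lparr>carrier := H\<rparr>\<^esub> g = id"
    using K.l_inv[of g] K.r_inv[of g] assms by (simp_all add: Iso_def)
  then show "(inv\<^bsub>Iso\<lparr>carrier := H\<rparr>\<^esub> g) (g x) = x" "g ((inv\<^bsub>Iso\<lparr>carrier := H\<rparr>\<^esub> g) x) = x"
    by (simp_all add: fun_eq_iff)
qed

lemma dist_inv_subgroup_Iso:
  assumes "g \<in> H"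
  shows "dist x ((inv\<^bsub>Iso\<lparr>carrier := H\<rparr>\<^esub> g) y) = dist (g x) y"
  using dist_subgroup_Iso[OF assms, of x "(inv\<^bsub>Iso\<lparr>carrier := H\<rparr>\<^esub> g) y"] inv_subgroup_Iso(3)[OF assms, of y]
  by simp

lemma topspace_simple_convergence_subgroup:
  "topspace (subtopology simple_convergence H) = H"
  using subgroup.subset[OF H] by (auto simp: simple_convergence_def)

lemma continuous_map_evaluation:
  "continuous_map (subtopology simple_convergence H) euclidean (\<lambda>g. g x)"
  unfolding simple_convergence_def
  by (intro continuous_map_from_subtopology continuous_map_product_projection) simp

lemma top_density_orbit_less:
  assumes "top_density (subtopology simple_convergence H) <o m"
  shows "top_density (top_of_set ((\<lambda>g. g x) ` H)) <o m"
proof (rule top_density_continuous_image_less[OF _ _ assms])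
  show "continuous_map (subtopology simple_convergence H) (top_of_set ((\<lambda>g. g x) ` H)) (\<lambda>g. g x)"
    using continuous_map_evaluation topspace_simple_convergence_subgroup
    by (auto simp: continuous_map_in_subtopology)
qed (simp add: topspace_simple_convergence_subgroup del: topspace_subtopology)

text \<open>Apply (OB) to the pseudometric \<open>dist (g x) (h x)\<close>: left-invariant because
  the group acts by isometries, continuous because evaluation at \<open>x\<close> is.\<close>

lemma property_OB_bounded_orbit:
  assumes OB: "property_OB (Iso\<lparr>carrier := H\<rparr>) (subtopology simple_convergence H)"
  shows "bounded ((\<lambda>g. g x) ` H)"
proof -
  let ?T = "subtopology simple_convergence H"
  have "left_invariant_pseudometric (Iso\<lparr>carrier := H\<rparr>) (\<lambda>g h. dist (g x) (h x))"
    by (auto simp: left_invariant_pseudometric_def dist_commute dist_triangle Iso_def dist_subgroup_Iso)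
  moreover have "continuous_map (prod_topology ?T ?T) euclideanreal (\<lambda>p. dist (fst p x) (snd p x))"
    by (rule continuous_map_mdist[where m = euclidean_metric, simplified])
      (auto intro!: continuous_map_compose[OF continuous_map_fst continuous_map_evaluation, unfolded comp_def]
        continuous_map_compose[OF continuous_map_snd continuous_map_evaluation, unfolded comp_def])
  then have "continuous_map (prod_topology ?T ?T) euclideanreal (\<lambda>(g, h). dist (g x) (h x))"
    by (simp add: case_prod_unfold)
  ultimately obtain C where "\<And>g h. g \<in> H \<Longrightarrow> h \<in> H \<Longrightarrow> dist (g x) (h x) \<le> C"
    using OB[unfolded property_OB_def, rule_format, of "\<lambda>g h. dist (g x) (h x)"] by auto
  then show ?thesis
    using id_in_subgroup_Iso unfolding bounded_def by blast
qed

lemma openin_simple_convergence_nhd: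
  assumes "openin (subtopology simple_convergence H) V" "id \<in> V"
  obtains F e where "finite F" "e > 0" "\<And>g. g \<in> H \<Longrightarrow> (\<forall>x\<in>F. dist x (g x) < e) \<Longrightarrow> g \<in> V"
proof -
  have "subtopology simple_convergence H = subtopology (product_topology (\<lambda>_. euclidean) UNIV) H"
    using subgroup.subset[OF H] by (simp add: simple_convergence_def subtopology_subtopology Int_absorb1)
  then obtain S :: "('u \<Rightarrow> 'u) set" where S: "openin (product_topology (\<lambda>_. euclidean) UNIV) S" "V = S \<inter> H"
    using assms(1) by (auto simp: openin_subtopology)
  then obtain U where U: "finite {i. U i \<noteq> UNIV}" "\<And>i. open (U i)" "id \<in> Pi\<^sub>E UNIV U" "Pi\<^sub>E UNIV U \<subseteq> S"
    using assms(2) by (auto simp: openin_product_topology_alt)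
  have "\<forall>i. \<exists>e>0. ball i e \<subseteq> U i"
    using U(2,3) by (metis PiE_mem UNIV_I id_apply open_contains_ball)
  then obtain r where r: "\<And>i. r i > 0" "\<And>i. ball i (r i) \<subseteq> U i" by metis
  define F where "F = {i. U i \<noteq> UNIV}"
  \<comment> \<open>The inserted 1 covers the case of empty \<open>F\<close>.\<close>
  define e where "e = Min (insert 1 (r ` F))"
  show thesis
  proof
    show "finite F" using U(1) by (simp add: F_def)
    then show "e > 0" using r(1) by (auto simp: e_def)
    fix g assume g: "g \<in> H" "\<forall>x\<in>F. dist x (g x) < e"
    have "g i \<in> U i" for i
    proof (cases "i \<in> F")
      case True
      then have "e \<le> r i" using \<open>finite F\<close> by (auto simp: e_def)
      then show ?thesis using True g(2) r(2)[of i] by force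
    qed (simp add: F_def)
    then have "g \<in> Pi\<^sub>E UNIV U" by auto
    then show "g \<in> V" using U(4) S(2) g(1) by blast
  qed
qed

lemma openin_simple_convergence_displacement:
  "openin (subtopology simple_convergence H) {g \<in> H. dist (g z) z < e}"
  using openin_continuous_map_preimage[OF continuous_map_evaluation[of z], of "ball z e"]
  by (simp add: topspace_simple_convergence_subgroup dist_commute del: topspace_subtopology)

section \<open>Merging finitely many control points into one\<close>

context
  fixes m :: "'m rel"
  assumes m: "Card_order m" "natLeq <o m" and U: "urysohn_katetov m TYPE('u)"
    and dens: "top_density (subtopology simple_convergence H) <o m"
    and bdd: "\<And>x. bounded ((\<lambda>g. g x) ` H)"
begin

text \<open>\<open>w\<close> is placed so that its distances to the two orbits detect displacement
  of \<open>a\<close> and of \<open>b\<close>. The tolerance \<open>e\<close> passes from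
  \<open>w\<close> to both points without loss, so the merging can be iterated.\<close>

lemma control_two_points:
  fixes a b :: 'u
  obtains w r where "r > 0"
    "\<And>g e. \<lbrakk>g \<in> H; e \<le> r; dist (g w) w < e\<rbrakk> \<Longrightarrow> dist (g a) a < e \<and> dist (g b) b < e"
proof (cases "a = b")
  case True
  then show thesis using that[of 1 a] by auto
next
  case False
  define r where "r = dist a b"
  have r: "r > 0" using False by (simp add: r_def)
  define Y where "Y = (\<lambda>g. g a) ` H \<union> (\<lambda>g. g b) ` H"
  have "bounded Y" using bdd by (simp add: Y_def)
  then obtain D where D: "\<And>x y. x \<in> Y \<Longrightarrow> y \<in> Y \<Longrightarrow> dist x y \<le> D"
    unfolding bounded_two_points by metis
  have Y: "g a \<in> Y" "g b \<in> Y" if "g \<in> H" for g using that by (auto simp: Y_def)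
  have ab: "a \<in> Y" "b \<in> Y" using Y[OF id_in_subgroup_Iso] by auto
  \<comment> \<open>If \<open>\<phi> (g a)\<close> is close to the minimum \<open>D\<close>, then \<open>g a\<close> is close to \<open>a\<close>. Now \<open>g b\<close> is at distance about
    \<open>r\<close> from \<open>a\<close>, so \<open>\<phi> (g b)\<close> close to \<open>D + r / 2\<close> forces the second branch, that is \<open>g b\<close> close to \<open>b\<close>.\<close>
  define \<phi> where "\<phi> y = D + min (dist y a) (r / 2 + dist y b)" for y
  have "\<exists>w. \<forall>y\<in>Y. dist w y = \<phi> y"
  proof (rule urysohn_katetov_one_point_extension[OF m U])
    show "top_density (top_of_set Y) <o m"
      unfolding Y_def by (intro top_density_Un_less[OF m] top_density_orbit_less dens)
    show "\<phi> x - \<phi> y \<le> dist x y" for x y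
      using dist_triangle[of x a y] dist_triangle[of x b y] by (auto simp: \<phi>_def min_def)
    \<comment> \<open>\<open>D\<close> bounds the diameter of \<open>Y\<close>, and both values of
      \<open>\<phi>\<close> are at least \<open>D\<close>.\<close>
    show "dist x y \<le> \<phi> x + \<phi> y" if "x \<in> Y" "y \<in> Y" for x y
    proof -
      have "0 \<le> D" using D[OF ab] zero_le_dist[of a b] by linarith
      moreover have "D \<le> \<phi> x" for x using r by (auto simp: \<phi>_def)
      ultimately show ?thesis using D[OF that] by (smt (verit))
    qed
  qed
  then obtain w where w: "\<And>y. y \<in> Y \<Longrightarrow> dist w y = \<phi> y"
    by blast
  show thesis
  \<comment> \<open>With \<open>e \<le> r / 4\<close> one has \<open>r - e \<ge> r / 2 + e\<close>,
    which rules out the first branch of the minimum at \<open>g b\<close>.\<close>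
  proof (rule that[of "r / 4" w])
    show "r / 4 > 0" using r by simp
    fix g e assume g: "g \<in> H" "e \<le> r / 4" "dist (g w) w < e"
    \<comment> \<open>As \<open>g\<close> moves \<open>w\<close> by less than \<open>e\<close>, the
      distances from \<open>w\<close> to \<open>x\<close> and to \<open>g x\<close> differ by less
      than \<open>e\<close>.\<close>
    have *: "\<phi> (g x) < \<phi> x + e" if "x \<in> {a, b}" for x
    proof -
      have "dist w (g x) \<le> dist w (g w) + dist (g w) (g x)"
        by (rule dist_triangle)
      also have "\<dots> < e + dist w x"
        using g(3) dist_subgroup_Iso[OF g(1)] by (simp add: dist_commute)
      finally show ?thesis
        using w[of x] w[of "g x"] Y[OF g(1)] ab that by auto
    qed
    have "min (dist (g a) a) (r / 2 + dist (g a) b) < e"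
      using *[of a] r by (simp add: \<phi>_def)
    moreover have "e \<le> r / 2 + dist (g a) b"
      using g(2) r zero_le_dist[of "g a" b] by linarith
    ultimately have 1: "dist (g a) a < e"
      by (auto simp: min_less_iff_disj)
    have "r \<le> dist (g b) a + dist (g a) a"
      using dist_triangle[of "g b" "g a" a] dist_subgroup_Iso[OF g(1), of a b]
      by (simp add: r_def dist_commute)
    then have "r / 2 + e \<le> dist (g b) a"
      using g(2) 1 by linarith
    moreover have "\<phi> b = D + r / 2"
      using r by (simp add: \<phi>_def r_def dist_commute)
    then have "min (dist (g b) a) (r / 2 + dist (g b) b) < r / 2 + e"
      using *[of b] by (simp add: \<phi>_def)
    ultimately have "dist (g b) b < e"
      by (auto simp: min_less_iff_disj)
    with 1 show "dist (g a) a < e \<and> dist (g b) b < e" ..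
  qed
qed

text \<open>If \<open>v\<close> controls \<open>F\<close>, a point controlling both \<open>a\<close>
  and \<open>v\<close> controls \<open>insert a F\<close>.\<close>

lemma control_finite_set:
  fixes F :: "'u set"
  assumes "finite F"
  shows "\<exists>w r. r > 0 \<and> (\<forall>g\<in>H. \<forall>e\<le>r. dist (g w) w < e \<longrightarrow> (\<forall>x\<in>F. dist (g x) x < e))"
  using assms
proof (induction F)
  case empty
  then show ?case by (auto intro: exI[of _ "1::real"])
next
  case (insert a F)
  then obtain v s where v: "s > 0" "\<And>g e. g \<in> H \<Longrightarrow> e \<le> s \<Longrightarrow> dist (g v) v < e \<Longrightarrow> \<forall>x\<in>F. dist (g x) x < e"
    by metis
  obtain w r where w: "r > 0"
    "\<And>g e. \<lbrakk>g \<in> H; e \<le> r; dist (g w) w < e\<rbrakk> \<Longrightarrow> dist (g a) a < e \<and> dist (g v) v < e"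
    using control_two_points[of a v] by metis
  show ?case
  proof (intro exI conjI ballI allI impI)
    show "min r s > 0" using v(1) w(1) by simp
    fix g e x assume g: "g \<in> H" "e \<le> min r s" "dist (g w) w < e" and x: "x \<in> insert a F"
    have "dist (g a) a < e \<and> dist (g v) v < e"
      using g by (intro w(2)) simp_all
    moreover from this have "\<forall>x\<in>F. dist (g x) x < e"
      using g by (intro v(2)) simp_all
    ultimately show "dist (g x) x < e"
      using x by blast
  qed
qed

section \<open>From right to left uniform continuity\<close>

lemma functionally_balanced_if_bounded_orbits:
  "functionally_balanced (Iso\<lparr>carrier := H\<rparr>) (subtopology simple_convergence H)"
  unfolding functionally_balanced_def left_uniformly_continuous_def
proof (intro allI impI, elim conjE)
  let ?G = "Iso\<lparr>carrier := H\<rparr>" and ?T = "subtopology simple_convergence H"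
  fix f :: "('u \<Rightarrow> 'u) \<Rightarrow> real" and \<epsilon> :: real
  assume f: "bounded (f ` carrier ?G)" "right_uniformly_continuous ?G ?T f" and "\<epsilon> > 0"
  \<comment> \<open>One third each for the approximation error at \<open>x\<close>, that at
    \<open>y\<close>, and the variation of \<open>\<psi>\<close>.\<close>
  define \<eta> where "\<eta> = \<epsilon> / 3"
  have \<eta>: "\<eta> > 0" using \<open>\<epsilon> > 0\<close> by (simp add: \<eta>_def)
  obtain B where B: "B > 0" "\<And>h. h \<in> H \<Longrightarrow> \<bar>f h\<bar> \<le> B"
    using f(1) by (auto simp: bounded_pos)
  obtain V where V: "openin ?T V" "id \<in> V"
    "\<And>g h. g \<in> H \<Longrightarrow> h \<in> H \<Longrightarrow> g \<circ> inv\<^bsub>?G\<^esub> h \<in> V \<Longrightarrow> \<bar>f g - f h\<bar> < \<eta>"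
    using f(2) \<eta> unfolding right_uniformly_continuous_def by (auto simp: Iso_def)
  obtain F s where F: "finite F" "s > 0" "\<And>g. g \<in> H \<Longrightarrow> (\<forall>x\<in>F. dist x (g x) < s) \<Longrightarrow> g \<in> V"
    using openin_simple_convergence_nhd[OF V(1,2)] by metis
  obtain w r where w: "r > 0"
    "\<And>g e. g \<in> H \<Longrightarrow> e \<le> r \<Longrightarrow> dist (g w) w < e \<Longrightarrow> \<forall>x\<in>F. dist (g x) x < e"
    using control_finite_set[OF F(1)] by metis
  \<comment> \<open>Below \<open>r\<close>, \<open>w\<close> controls \<open>F\<close>; below
    \<open>s\<close>, the control of \<open>F\<close> yields membership in \<open>V\<close>.\<close>
  define \<delta> where "\<delta> = min r s"
  have \<delta>: "\<delta> > 0" using w(1) F(2) by (simp add: \<delta>_def)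
  define i where "i = m_inv ?G"
  have i: "i h \<in> H" "i h (h x) = x" "h (i h x) = x" "dist x (i h y) = dist (h x) y" if "h \<in> H" for h x y
    using inv_subgroup_Iso[OF that] dist_inv_subgroup_Iso[OF that] by (simp_all add: i_def)
  \<comment> \<open>The displacement of \<open>w\<close> under \<open>g \<circ> i h\<close> equals
    \<open>dist (i g w) (i h w)\<close>, so \<open>f\<close> nearly depends on the orbit point
    \<open>i g w\<close> alone.\<close>
  have uc: "\<bar>f g - f h\<bar> < \<eta>" if gh: "g \<in> H" "h \<in> H" "dist (i g w) (i h w) < \<delta>" for g h
  proof -
    have "dist ((g \<circ> i h) w) w < \<delta>"
      using gh i by (metis comp_apply dist_commute)
    moreover have gh_H: "g \<circ> i h \<in> H"
      using gh i(1) by (intro comp_in_subgroup_Iso)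
    ultimately have "\<forall>x\<in>F. dist ((g \<circ> i h) x) x < \<delta>"
      by (intro w(2)) (simp_all add: \<delta>_def del: comp_apply)
    then have "g \<circ> i h \<in> V"
      by (intro F(3)[OF gh_H]) (simp add: \<delta>_def dist_commute del: comp_apply)
    then show ?thesis using V(3) gh by (simp add: i_def)
  qed
  define K where "K = 2 * B / \<delta>"
  have K: "K > 0" using B(1) \<delta> by (simp add: K_def)
  \<comment> \<open>The largest \<open>K\<close>-Lipschitz function with \<open>\<psi> (inv h w) \<le> f h\<close>; the slope \<open>K\<close> is chosen so that points
    of the orbit at distance at least \<open>\<delta>\<close> from \<open>inv g w\<close> do not lower \<open>\<psi> (inv g w)\<close> below \<open>f g\<close>.\<close>
  define \<psi> where "\<psi> y = (INF h\<in>H. f h + K * dist y (i h w))" for y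
  \<comment> \<open>Nonemptiness and the lower bound \<open>- B\<close> make the real infimum a
    genuine one.\<close>
  have ne: "H \<noteq> {}" using id_in_subgroup_Iso by blast
  have low: "- B \<le> f h + K * dist y (i h w)" if "h \<in> H" for h y
    using B(2)[OF that] K zero_le_dist[of y "i h w"] mult_nonneg_nonneg[of K "dist y (i h w)"] by linarith
  have bb: "bdd_below ((\<lambda>h. f h + K * dist y (i h w)) ` H)" for y
    using low by (intro bdd_belowI[of _ "- B"]) auto
  have \<psi>_low: "- B \<le> \<psi> y" for y
    unfolding \<psi>_def using ne low by (intro cINF_greatest)
  have \<psi>_lip: "\<psi> x \<le> \<psi> y + K * dist x y" for x y
  proof -
    have "\<psi> x - K * dist x y \<le> f h + K * dist y (i h w)" if "h \<in> H" for h
    proof -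
      have "\<psi> x \<le> f h + K * dist x (i h w)"
        unfolding \<psi>_def using that by (rule cINF_lower[OF bb])
      also have "\<dots> \<le> f h + K * (dist x y + dist y (i h w))"
        using K by (simp add: dist_triangle)
      finally show ?thesis by (simp add: algebra_simps)
    qed
    then have "\<psi> x - K * dist x y \<le> \<psi> y"
      unfolding \<psi>_def[of y] using ne by (intro cINF_greatest)
    then show ?thesis by simp
  qed
  have \<psi>_f: "\<psi> (i g w) \<le> f g" "f g - \<eta> \<le> \<psi> (i g w)" if "g \<in> H" for g
  proof -
    show "\<psi> (i g w) \<le> f g"
      unfolding \<psi>_def using cINF_lower[OF bb that, of "i g w"] by simp
    show "f g - \<eta> \<le> \<psi> (i g w)"
      unfolding \<psi>_def
    proof (rule cINF_greatest[OF ne])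
      fix h assume h: "h \<in> H"
      show "f g - \<eta> \<le> f h + K * dist (i g w) (i h w)"
      \<comment> \<open>For nearby orbit points \<open>uc\<close> costs only \<open>\<eta>\<close>;
        for distant ones the slope term is at least \<open>2 * B\<close>, the largest possible
        oscillation of \<open>f\<close>.\<close>
      proof (cases "dist (i g w) (i h w) < \<delta>")
        case True
        have "0 \<le> K * dist (i g w) (i h w)" using K by simp
        then show ?thesis using uc[OF that h True] by linarith
      next
        case False
        then have "K * \<delta> \<le> K * dist (i g w) (i h w)" using K by simp
        moreover have "K * \<delta> = 2 * B" using \<delta> by (simp add: K_def)
        ultimately show ?thesis using B(2)[OF that] B(2)[OF h] \<eta> by linarith
      qed
    qed
  qed
  let ?Y = "(\<lambda>g. g w) ` H"
  obtain D where D: "\<And>x y. x \<in> ?Y \<Longrightarrow> y \<in> ?Y \<Longrightarrow> dist x y \<le> D"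
    using bdd[of w] unfolding bounded_two_points by metis
  \<comment> \<open>Division by \<open>K\<close> makes the function 1-Lipschitz, adding
    \<open>B\<close> makes \<open>\<psi>\<close> nonnegative, and two halves of the diameter bound
    \<open>D\<close> give the Katetov inequality.\<close>
  define \<phi> where "\<phi> y = D / 2 + (B + \<psi> y) / K" for y
  have "\<exists>z. \<forall>y\<in>?Y. dist z y = \<phi> y"
  proof (rule urysohn_katetov_one_point_extension[OF m U top_density_orbit_less[OF dens]])
    show "\<phi> x - \<phi> y \<le> dist x y" for x y
    proof -
      have "\<phi> x - \<phi> y = (\<psi> x - \<psi> y) / K"
        by (simp add: \<phi>_def diff_divide_distrib add_divide_distrib)
      then show ?thesis
        using \<psi>_lip[of x y] K by (simp add: pos_divide_le_eq mult.commute)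
    qed
    show "dist x y \<le> \<phi> x + \<phi> y" if "x \<in> ?Y" "y \<in> ?Y" for x y
    proof -
      have "0 \<le> (B + \<psi> x) / K" for x using \<psi>_low[of x] K by simp
      from this[of x] this[of y] show ?thesis using D[OF that] by (simp add: \<phi>_def)
    qed
  qed
  then obtain z where z: "\<And>y. y \<in> ?Y \<Longrightarrow> dist z y = \<phi> y"
    by blast
  show "\<exists>W. openin ?T W \<and> \<one>\<^bsub>?G\<^esub> \<in> W \<and>
    (\<forall>x\<in>carrier ?G. \<forall>y\<in>carrier ?G. inv\<^bsub>?G\<^esub> x \<otimes>\<^bsub>?G\<^esub> y \<in> W \<longrightarrow> \<bar>f x - f y\<bar> < \<epsilon>)"
  \<comment> \<open>A change of \<open>\<phi>\<close> by less than \<open>\<eta> / K\<close> is a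
    change of \<open>\<psi>\<close> by less than \<open>\<eta>\<close>.\<close>
  proof (intro exI[of _ "{u \<in> H. dist (u z) z < \<eta> / K}"] conjI ballI impI)
    show "openin ?T {u \<in> H. dist (u z) z < \<eta> / K}"
      by (rule openin_simple_convergence_displacement)
    show "\<one>\<^bsub>?G\<^esub> \<in> {u \<in> H. dist (u z) z < \<eta> / K}"
      using id_in_subgroup_Iso \<eta> K by (simp add: Iso_def)
    fix x y assume "x \<in> carrier ?G" "y \<in> carrier ?G"
      "inv\<^bsub>?G\<^esub> x \<otimes>\<^bsub>?G\<^esub> y \<in> {u \<in> H. dist (u z) z < \<eta> / K}"
    then have xy: "x \<in> H" "y \<in> H" "dist (i x (y z)) z < \<eta> / K"
      by (auto simp: Iso_def i_def)
    have "dist (y z) (x z) < \<eta> / K"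
      using xy i by (metis dist_commute)
    \<comment> \<open>Moving the isometry across the distance turns evaluation of
      \<open>\<phi>\<close> at \<open>i x w\<close> into the distance from \<open>x z\<close> to the
      fixed point \<open>w\<close>, so moving \<open>z\<close> alone bounds the change at every
      orbit point.\<close>
    moreover have "dist (x z) w = \<phi> (i x w)" "dist (y z) w = \<phi> (i y w)"
      using xy i(1,4) z by (metis imageI)+
    ultimately have "\<bar>\<phi> (i x w) - \<phi> (i y w)\<bar> < \<eta> / K"
      using abs_dist_diff_le[of "x z" w "y z"] by (simp add: dist_commute)
    moreover have "\<phi> (i x w) - \<phi> (i y w) = (\<psi> (i x w) - \<psi> (i y w)) / K"
      by (simp add: \<phi>_def diff_divide_distrib add_divide_distrib)
    ultimately have "\<bar>\<psi> (i x w) - \<psi> (i y w)\<bar> < \<eta>"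
      using K by (simp add: abs_divide divide_less_cancel)
    then show "\<bar>f x - f y\<bar> < \<epsilon>"
      using \<psi>_f[OF xy(1)] \<psi>_f[OF xy(2)] unfolding \<eta>_def by linarith
  qed
qed

end

end

theorem theorem5p1:
  fixes m :: "'m rel" and H :: "('u::metric_space \<Rightarrow> 'u) set"
  assumes "Card_order m"
    and "natLeq <o m"
    and "is_card_Sup {m ^c n | n :: 'm rel. Card_order n \<and> n <o m} m"
    and "urysohn_katetov m TYPE('u)"
    and "subgroup H Iso"
    and "top_density (subtopology simple_convergence H) <o m"
    and "property_OB (Iso\<lparr>carrier := H\<rparr>) (subtopology simple_convergence H)"
  shows "functionally_balanced (Iso\<lparr>carrier := H\<rparr>) (subtopology simple_convergence H)"
  by (rule functionally_balanced_if_bounded_orbits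
      [OF assms(5,1,2,4,6) property_OB_bounded_orbit[OF assms(5,7)]])

end
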